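(* Let $n\ge1$, $r\in\mathbb{Z}$, and $z_1\neq z_2$ complex numbers. The bi-bordered $2j-k$ determinant $F^{(2)}_n(z_1,z_2)=\mathcal{D}_n\left[w(\zeta)\zeta^{-r}(z_1-\zeta^{-2})(z_2-\zeta^{-2})\right]$ has the following representation in terms of the $Q$-polynomials: $$\mathcal{D}_n\left[w(\zeta)\zeta^{-r}(z_1-\zeta^{-2})(z_2-\zeta^{-2})\right]=D^{(r)}_n\,\frac{Q_n(z_1;r)Q_{n+1}(z_2;r)-Q_n(z_2;r)Q_{n+1}(z_1;r)}{z_2-z_1}.$$
   Context: $w$ is an integrable weight function on the unit circle $\mathbb{T}$ with moments $w_\ell=\int_{\mathbb{T}} w(\zeta)\zeta^{-\ell}\frac{d\zeta}{2\pi \mathrm{i}\zeta}$, $\ell\in\mathbb{Z}$. For an integrable function $f$ on $\mathbb{T}$, $$\mathcal{D}_n[f(\zeta)]:=\frac{1}{n!}\int_{\mathbb{T}}\frac{d\zeta_1}{2\pi \mathrm{i}\zeta_1}\cdots\int_{\mathbb{T}}\frac{d\zeta_n}{2\pi \mathrm{i}\zeta_n}\prod_{j=1}^nf(\zeta_j)\prod_{1\le j<k\le n}(\zeta_k-\zeta_j)(\zeta_k^{-2}-\zeta_j^{-2}).$$ $F^{(2)}_n(z_1,z_2)$ is $\frac{1}{z_1-z_2}$ times the determinant of the $(n+2)\times(n+2)$ matrix whose row $j$ ($0\le j\le n+1$) is $(w_{r+2j},w_{r+2j-1},\dots,w_{r+2j-n+1},z_2^j,z_1^j)$. $D^{(r)}_k:=\det(w_{2i-l+r})_{0\le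 i,l\le k-1}$, $D_0^{(r)}:=1$. When $D^{(r)}_k\ne0$, $Q_k(z;r)$ is the unique monic polynomial of degree $k$ with $\int_{\mathbb{T}}Q_k(\zeta^{-2};r)\zeta^{l-r}w(\zeta)\frac{d\zeta}{2\pi \mathrm{i}\zeta}=0$ for $l=0,\dots,k-1$; it equals $1/D_k^{(r)}$ times the determinant of the $(k+1)\times(k+1)$ matrix with rows $(w_{r+2i},w_{r+2i-1},\dots,w_{r+2i-k+1},z^i)$, $0\le i\le k$. Standing assumption: $D_k^{(r)}\neq0$ for $0\le k\le n+1$. *)

theory Defs
  imports
    "HOL-Complex_Analysis.Complex_Analysis"
    "Jordan_Normal_Form.Determinant"
begin

text \<open>Lebesgue integrability on the unit circle with respect to arc length;
  \<open>circlepath 0 1 t = exp (2 * pi * \<i> * t)\<close>.\<close>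

definition integrable_on_circle :: "(complex \<Rightarrow> complex) \<Rightarrow> bool" where
  "integrable_on_circle f \<longleftrightarrow> (\<lambda>t. f (circlepath 0 1 t)) absolutely_integrable_on {0..1}"

definition circle_integral :: "(complex \<Rightarrow> complex) \<Rightarrow> complex" where
  "circle_integral f =
     contour_integral (circlepath 0 1) (\<lambda>\<zeta>. f \<zeta> / (2 * complex_of_real pi * \<i> * \<zeta>))"

text \<open>The iterated integral over the variables \<open>\<zeta> 1, \<dots>, \<zeta> n\<close>, with \<open>\<zeta> 1\<close> outermost and
  \<open>\<zeta> n\<close> innermost. The coordinates of \<open>\<zeta>\<close> outside \<open>{1..n}\<close> are set to \<open>0\<close>; the integrands
  below do not depend on them.\<close>

primrec iterated_circle_integral :: "nat \<Rightarrow> ((nat \<Rightarrow> complex) \<Rightarrow> complex) \<Rightarrow> complex" where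
  "iterated_circle_integral 0 F = F (\<lambda>_. 0)"
| "iterated_circle_integral (Suc n) F =
     iterated_circle_integral n (\<lambda>\<zeta>. circle_integral (\<lambda>x. F (\<zeta>(Suc n := x))))"

definition moment :: "(complex \<Rightarrow> complex) \<Rightarrow> int \<Rightarrow> complex" where
  "moment w l = circle_integral (\<lambda>\<zeta>. w \<zeta> * \<zeta> powi (- l))"

definition D_multi :: "nat \<Rightarrow> (complex \<Rightarrow> complex) \<Rightarrow> complex" where
  "D_multi n f = 1 / fact n * iterated_circle_integral n
     (\<lambda>\<zeta>. (\<Prod>j=1..n. f (\<zeta> j)) *
          (\<Prod>k=1..n. \<Prod>j=1..<k. (\<zeta> k - \<zeta> j) * (\<zeta> k powi (-2) - \<zeta> j powi (-2))))"

text \<open>\<open>Determinant.det\<close> and \<open>Matrix.mat\<close> are qualified because \<open>HOL-Analysis\<close> has constants of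
  the same name. For \<open>k = 0\<close> the determinant is that of the empty matrix, i.e. \<open>1\<close>.\<close>

definition D_det :: "(complex \<Rightarrow> complex) \<Rightarrow> int \<Rightarrow> nat \<Rightarrow> complex" where
  "D_det w r k = Determinant.det (Matrix.mat k k (\<lambda>(i, l). moment w (2 * int i - int l + r)))"

definition Q_poly :: "(complex \<Rightarrow> complex) \<Rightarrow> int \<Rightarrow> nat \<Rightarrow> complex poly" where
  "Q_poly w r k = (THE p. degree p = k \<and> lead_coeff p = 1 \<and>
     (\<forall>l<k. circle_integral (\<lambda>\<zeta>. poly p (\<zeta> powi (-2)) * \<zeta> powi (int l - r) * w \<zeta>) = 0))"

definition F2 :: "(complex \<Rightarrow> complex) \<Rightarrow> int \<Rightarrow> nat \<Rightarrow> complex \<Rightarrow> complex \<Rightarrow> complex" where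
  "F2 w r n z1 z2 = 1 / (z1 - z2) *
     Determinant.det (Matrix.mat (n + 2) (n + 2) (\<lambda>(j, l).
       if l < n then moment w (r + 2 * int j - int l)
       else if l = n then z2 ^ j
       else z1 ^ j))"

end

theory Submission
  imports Defs
begin

text \<open>
  Write \<open>u = \<zeta> powi (-2)\<close>. Column \<open>l < n\<close> of the bordered matrix is a linear functional applied to
  the monomials \<open>u^j\<close> indexing the rows, namely \<open>p \<mapsto> \<integral> p(u) \<zeta>^(l-r) w(\<zeta>)\<close>; the last two columns are
  the evaluations at \<open>z2\<close> and \<open>z1\<close>. Replacing the monomials by any other family of monic polynomials
  of degrees \<open>0, 1, \<dots>, n + 1\<close> is a unitriangular row operation and leaves the determinant unchanged
  (\<open>F2_monic_basis\<close>). Two choices of such a family give the two equalities.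

  For \<open>1, u - z2, (z1 - u) (z2 - u) u^i\<close> with \<open>i < n\<close>, the border columns vanish outside the first
  two rows, where they have determinant \<open>z1 - z2\<close>. The remaining \<open>n \<times> n\<close> block consists of the
  integrals \<open>\<integral> f(\<zeta>) \<zeta>^l u^i\<close> with \<open>f = w \<zeta>^(-r) (z1 - u) (z2 - u)\<close>, and its determinant is \<open>D_multi n f\<close>
  by Andreief's identity, since the two products of differences in the multiple integral are
  Vandermonde determinants (\<open>D_multi_eq_det\<close>).

  For \<open>1, u, \<dots>, u^(n-1), Q_n, Q_(n+1)\<close>, orthogonality makes the first \<open>n\<close> columns vanish in the last
  two rows. So the determinant is \<open>D_n\<close> times the \<open>2 \<times> 2\<close> determinant of the values of \<open>Q_n\<close> and
  \<open>Q_(n+1)\<close> at \<open>z2\<close> and \<open>z1\<close>.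

  Fubini's theorem does not enter: after the determinants are expanded, the integrand is a finite sum
  of products of functions of one variable, and each single integral is linear.
\<close>

section \<open>Integration over the unit circle\<close>

lemma circle_integral_eq_integral:
  "circle_integral f = integral {0..1} (\<lambda>t. f (circlepath 0 1 t))"
  unfolding circle_integral_def contour_integral_integral vector_derivative_circlepath
  by (intro integral_cong) (simp add: circlepath field_simps)

lemma circle_integral_cong:
  assumes "\<And>\<zeta>. norm \<zeta> = 1 \<Longrightarrow> f \<zeta> = g \<zeta>"
  shows "circle_integral f = circle_integral g"
  unfolding circle_integral_eq_integral
  by (intro integral_cong assms) (simp add: circlepath)

lemma integrable_on_circle_cong:
  assumes "\<And>\<zeta>. norm \<zeta> = 1 \<Longrightarrow> f \<zeta> = g \<zeta>"
  shows "integrable_on_circle f \<longleftrightarrow> integrable_on_circle g"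
proof -
  have "(\<lambda>t. f (circlepath 0 1 t)) = (\<lambda>t. g (circlepath 0 1 t))"
    by (intro ext assms) (simp add: circlepath)
  then show ?thesis by (simp add: integrable_on_circle_def)
qed

lemma integrable_on_circle_sum:
  assumes "finite S" "\<And>s. s \<in> S \<Longrightarrow> integrable_on_circle (g s)"
  shows "integrable_on_circle (\<lambda>\<zeta>. \<Sum>s\<in>S. c s * g s \<zeta>)"
  unfolding integrable_on_circle_def
proof (rule absolutely_integrable_sum[OF assms(1)])
  fix s assume "s \<in> S"
  from assms(2)[OF this] show "(\<lambda>t. c s * g s (circlepath 0 1 t)) absolutely_integrable_on {0..1}"
    unfolding integrable_on_circle_def by (rule set_integrable_mult_right[rotated])
qed

lemma circle_integral_sum:
  assumes "finite S" "\<And>s. s \<in> S \<Longrightarrow> integrable_on_circle (g s)"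
  shows "circle_integral (\<lambda>\<zeta>. \<Sum>s\<in>S. c s * g s \<zeta>) = (\<Sum>s\<in>S. c s * circle_integral (g s))"
proof -
  have int: "(\<lambda>t. g s (circlepath 0 1 t)) integrable_on {0..1}" if "s \<in> S" for s
    using assms(2)[OF that] unfolding integrable_on_circle_def
    by (rule set_lebesgue_integral_eq_integral(1))
  show ?thesis
    unfolding circle_integral_eq_integral
    by (subst integral_sum[OF assms(1)]) (auto intro!: integrable_on_mult_right int)
qed

text \<open>The weight is only integrable; the power is continuous, hence bounded, on the circle.\<close>

lemma integrable_on_circle_mult_powi:
  assumes "integrable_on_circle w"
  shows "integrable_on_circle (\<lambda>\<zeta>. w \<zeta> * \<zeta> powi m)"
proof -
  have cont: "continuous_on {0..1} (\<lambda>t. circlepath 0 1 t powi m)"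
    by (auto simp: circlepath intro!: continuous_intros)
  have "(\<lambda>t. circlepath 0 1 t powi m * w (circlepath 0 1 t))
          absolutely_integrable_on {0..1}"
  proof (rule absolutely_integrable_bounded_measurable_product
      [where h = "\<lambda>x y. x * y" and f = "\<lambda>t. circlepath 0 1 t powi m"])
    show "bilinear (\<lambda>x y :: complex. x * y)"
      using bilinear_conv_bounded_bilinear bounded_bilinear_mult by blast
    show "(\<lambda>t. circlepath 0 1 t powi m) \<in> borel_measurable (lebesgue_on {0..1})"
      using cont by (rule continuous_imp_measurable_on_sets_lebesgue) auto
    show "bounded ((\<lambda>t. circlepath 0 1 t powi m) ` {0..1})"
      using cont by (intro compact_imp_bounded compact_continuous_image) auto
    show "(\<lambda>t. w (circlepath 0 1 t)) absolutely_integrable_on {0..1}"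
      using assms unfolding integrable_on_circle_def .
  qed auto
  then show ?thesis by (simp add: integrable_on_circle_def mult.commute)
qed

text \<open>The innermost integral of a sum of products is again a sum of products in the remaining
  variables, with the coefficients \<open>c s\<close> multiplied by the integral of the last factor. The induction
  therefore runs over all coefficient families.\<close>

lemma iterated_circle_integral_sum_prod:
  assumes "finite S" "\<And>s i. s \<in> S \<Longrightarrow> i < n \<Longrightarrow> integrable_on_circle (g s i)"
  shows "iterated_circle_integral n (\<lambda>\<zeta>. \<Sum>s\<in>S. c s * (\<Prod>i<n. g s i (\<zeta> (Suc i))))
       = (\<Sum>s\<in>S. c s * (\<Prod>i<n. circle_integral (g s i)))"
  using assms(2)
proof (induction n arbitrary: c)
  case 0
  then show ?case by simp
next
  case (Suc n)
  have "circle_integral (\<lambda>x. \<Sum>s\<in>S. c s * (\<Prod>i<Suc n. g s i ((\<zeta>(Suc n := x)) (Suc i))))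
      = (\<Sum>s\<in>S. (c s * circle_integral (g s n)) * (\<Prod>i<n. g s i (\<zeta> (Suc i))))" for \<zeta>
  proof -
    have "(\<lambda>x. \<Sum>s\<in>S. c s * (\<Prod>i<Suc n. g s i ((\<zeta>(Suc n := x)) (Suc i))))
        = (\<lambda>x. \<Sum>s\<in>S. (c s * (\<Prod>i<n. g s i (\<zeta> (Suc i)))) * g s n x)"
      by (intro ext sum.cong) (auto simp: mult.assoc)
    then show ?thesis
      by (simp only:) (subst circle_integral_sum, use assms(1) Suc.prems in \<open>auto simp: mult_ac\<close>)
  qed
  then have "iterated_circle_integral (Suc n) (\<lambda>\<zeta>. \<Sum>s\<in>S. c s * (\<Prod>i<Suc n. g s i (\<zeta> (Suc i))))
     = (\<Sum>s\<in>S. (c s * circle_integral (g s n)) * (\<Prod>i<n. circle_integral (g s i)))"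
    using Suc.IH[of "\<lambda>s. c s * circle_integral (g s n)"] Suc.prems by simp
  then show ?case by (simp add: mult_ac)
qed

lemma circle_integral_poly_moments:
  assumes "integrable_on_circle w"
  shows "integrable_on_circle (\<lambda>\<zeta>. poly p (\<zeta> powi (-2)) * \<zeta> powi m * w \<zeta>)"
    and "circle_integral (\<lambda>\<zeta>. poly p (\<zeta> powi (-2)) * \<zeta> powi m * w \<zeta>)
       = (\<Sum>j\<le>degree p. coeff p j * moment w (2 * int j - m))"
proof -
  have eq: "poly p (\<zeta> powi (-2)) * \<zeta> powi m * w \<zeta>
      = (\<Sum>j\<le>degree p. coeff p j * (w \<zeta> * \<zeta> powi (- (2 * int j - m))))" if "norm \<zeta> = 1" for \<zeta>
  proof -
    have "\<zeta> \<noteq> 0" using that by auto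
    have "(\<zeta> powi (-2)) ^ j * \<zeta> powi m = \<zeta> powi (- (2 * int j - m))" for j
    proof -
      have "(\<zeta> powi (-2)) ^ j = \<zeta> powi (-2 * int j)"
        by (metis power_int_mult power_int_of_nat)
      then show ?thesis
        using \<open>\<zeta> \<noteq> 0\<close> by (simp add: power_int_add[symmetric])
    qed
    then have "coeff p j * (\<zeta> powi (-2)) ^ j * \<zeta> powi m * w \<zeta>
        = coeff p j * (w \<zeta> * \<zeta> powi (- (2 * int j - m)))" for j
      by (metis mult.assoc mult.commute)
    then show ?thesis
      by (simp only: poly_altdef sum_distrib_right)
  qed
  note int = integrable_on_circle_mult_powi[OF assms]
  show "integrable_on_circle (\<lambda>\<zeta>. poly p (\<zeta> powi (-2)) * \<zeta> powi m * w \<zeta>)"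
    by (subst integrable_on_circle_cong[OF eq]) (auto intro: integrable_on_circle_sum int)
  show "circle_integral (\<lambda>\<zeta>. poly p (\<zeta> powi (-2)) * \<zeta> powi m * w \<zeta>)
       = (\<Sum>j\<le>degree p. coeff p j * moment w (2 * int j - m))"
    unfolding moment_def
    by (subst circle_integral_cong[OF eq]) (auto intro: circle_integral_sum int)
qed

section \<open>Determinants\<close>

text \<open>The coefficients of the \<open>p i\<close> form a lower unitriangular matrix, which multiplies the given one
  from the left.\<close>

lemma det_monic_rows:
  fixes a :: "nat \<Rightarrow> nat \<Rightarrow> 'a :: comm_ring_1"
  assumes "\<And>i. i < n \<Longrightarrow> degree (p i) = i" "\<And>i. i < n \<Longrightarrow> lead_coeff (p i) = 1"
  shows "Determinant.det (Matrix.mat n n (\<lambda>(i, l). \<Sum>j\<le>i. coeff (p i) j * a j l))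
       = Determinant.det (Matrix.mat n n (\<lambda>(i, l). a i l))"
proof -
  let ?C = "Matrix.mat n n (\<lambda>(i, j). coeff (p i) j)"
  let ?A = "Matrix.mat n n (\<lambda>(i, l). a i l)"
  have "Matrix.mat n n (\<lambda>(i, l). \<Sum>j\<le>i. coeff (p i) j * a j l) = ?C * ?A"
  proof (rule eq_matI)
    fix i l assume "i < dim_row (?C * ?A)" "l < dim_col (?C * ?A)"
    then have il: "i < n" "l < n" by auto
    have "(\<Sum>j\<le>i. coeff (p i) j * a j l) = (\<Sum>j = 0..<n. coeff (p i) j * a j l)"
      using assms(1)[of i] il by (intro sum.mono_neutral_left) (auto simp: coeff_eq_0)
    then show "Matrix.mat n n (\<lambda>(i, l). \<Sum>j\<le>i. coeff (p i) j * a j l) $$ (i, l) = (?C * ?A) $$ (i, l)"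
      using il by (simp add: scalar_prod_def)
  qed auto
  moreover have "Determinant.det ?C = 1"
  proof -
    have "Determinant.det ?C = prod_list (diag_mat ?C)"
      by (rule det_lower_triangular[of n]) (auto simp: coeff_eq_0 assms(1))
    also have "\<dots> = (\<Prod>i = 0..<n. coeff (p i) i)"
      by (simp add: prod_list_diag_prod)
    also have "\<dots> = 1" using assms by (intro prod.neutral) force
    finally show ?thesis .
  qed
  ultimately show ?thesis by (simp add: det_mult[of _ n])
qed

text \<open>The Newton polynomials \<open>(X - x 0) \<cdots> (X - x (i - 1))\<close> as a monic basis turn the
  matrix of powers into an upper triangular one.\<close>

lemma det_vandermonde:
  fixes x :: "nat \<Rightarrow> 'a :: idom"
  shows "Determinant.det (Matrix.mat n n (\<lambda>(i, l). x l ^ i)) = (\<Prod>k<n. \<Prod>j<k. x k - x j)"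
proof -
  define p where "p i = (\<Prod>j<i. [:- x j, 1:])" for i
  have deg: "degree (p i) = i" for i
    unfolding p_def by (subst degree_prod_sum_eq) auto
  have lead: "lead_coeff (p i) = 1" for i
    unfolding p_def by (simp add: lead_coeff_prod)
  have ev: "poly (p i) y = (\<Prod>j<i. y - x j)" for i y
    unfolding p_def by (simp add: poly_prod)
  have "Determinant.det (Matrix.mat n n (\<lambda>(i, l). x l ^ i))
      = Determinant.det (Matrix.mat n n (\<lambda>(i, l). \<Sum>j\<le>i. coeff (p i) j * x l ^ j))"
    using det_monic_rows[of n p "\<lambda>i l. x l ^ i"] deg lead by simp
  also have "\<dots> = Determinant.det (Matrix.mat n n (\<lambda>(i, l). \<Prod>j<i. x l - x j))"
    by (simp add: ev[symmetric] poly_altdef deg)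
  also have "\<dots> = prod_list (diag_mat (Matrix.mat n n (\<lambda>(i, l). \<Prod>j<i. x l - x j)))"
    by (rule det_upper_triangular[of _ n]) (auto simp: upper_triangular_def)
  also have "\<dots> = (\<Prod>k = 0..<n. \<Prod>j<k. x k - x j)"
    by (simp add: prod_list_diag_prod)
  finally show ?thesis by (simp add: atLeast0LessThan)
qed

lemma det_block_lower_left_zero:
  fixes a :: "nat \<Rightarrow> nat \<Rightarrow> 'a :: idom"
  assumes "\<And>i l. n \<le> i \<Longrightarrow> i < n + m \<Longrightarrow> l < n \<Longrightarrow> a i l = 0"
  shows "Determinant.det (Matrix.mat (n + m) (n + m) (\<lambda>(i, l). a i l))
       = Determinant.det (Matrix.mat n n (\<lambda>(i, l). a i l)) *
         Determinant.det (Matrix.mat m m (\<lambda>(i, l). a (n + i) (n + l)))"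
proof -
  let ?A1 = "Matrix.mat n n (\<lambda>(i, l). a i l)"
  let ?A2 = "Matrix.mat n m (\<lambda>(i, l). a i (n + l))"
  let ?A4 = "Matrix.mat m m (\<lambda>(i, l). a (n + i) (n + l))"
  have "Matrix.mat (n + m) (n + m) (\<lambda>(i, l). a i l) = four_block_mat ?A1 ?A2 (0\<^sub>m m n) ?A4"
    by (rule eq_matI) (auto simp: assms)
  then show ?thesis
    by (simp add: det_four_block_mat_lower_left_zero[of _ n _ m])
qed

lemma det_two_by_two:
  "Determinant.det (Matrix.mat 2 2 (\<lambda>(i, l). a i l)) = a 0 0 * a 1 1 - a 0 1 * (a 1 0 :: 'a :: idom)"
proof -
  have *: "Matrix.mat 2 2 (\<lambda>(i, l). a i l) = four_block_mat
      (Matrix.mat 1 1 (\<lambda>_. a 0 0)) (Matrix.mat 1 1 (\<lambda>_. a 0 1))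
      (Matrix.mat 1 1 (\<lambda>_. a 1 0)) (Matrix.mat 1 1 (\<lambda>_. a 1 1))"
    by (rule eq_matI) (auto simp: less_2_cases_iff numeral_2_eq_2 less_Suc_eq)
  show ?thesis unfolding *
    apply (subst det_four_block_mat[of _ 1])
         prefer 6
         apply (subst det_single)
          apply (auto simp: scalar_prod_def intro!: eq_matI)
    done
qed

text \<open>The two top rows carry the only nonzero entries of the two last columns. Moving them to the
  bottom passes each over \<open>n\<close> rows, so the sign is \<open>(-1)^(2 * n) = 1\<close>.\<close>

lemma det_block_lower_right_zero:
  fixes a :: "nat \<Rightarrow> nat \<Rightarrow> 'a :: idom"
  assumes "\<And>i l. i < n \<Longrightarrow> l < 2 \<Longrightarrow> a (i + 2) (n + l) = 0"
  shows "Determinant.det (Matrix.mat (n + 2) (n + 2) (\<lambda>(i, l). a i l))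
       = Determinant.det (Matrix.mat n n (\<lambda>(i, l). a (i + 2) l)) *
         Determinant.det (Matrix.mat 2 2 (\<lambda>(i, l). a i (n + l)))"
proof -
  let ?b = "\<lambda>i l. a (if i < n then i + 2 else i - n) l"
  let ?N = "Matrix.mat n n (\<lambda>(i, l). a (i + 2) l)"
  let ?A = "Matrix.mat 2 n (\<lambda>(i, l). a i l)"
  let ?B = "Matrix.mat 2 2 (\<lambda>(i, l). a i (n + l))"
  have "Determinant.det (Matrix.mat (n + 2) (n + 2) (\<lambda>(i, l). a i l))
      = Determinant.det (Matrix.mat (n + 2) (n + 2) (\<lambda>(i, l). ?b i l))"
    by (subst det_swap_initial_rows[of _ "n + 2" 2 n])
      (auto intro!: arg_cong[where f = Determinant.det] eq_matI)
  also have "Matrix.mat (n + 2) (n + 2) (\<lambda>(i, l). ?b i l) = four_block_mat ?N (0\<^sub>m n 2) ?A ?B"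
  proof (intro eq_matI)
    have "a (i + 2) l = 0" if "i < n" "n \<le> l" "l < n + 2" for i l
      using assms[of i "l - n"] that by simp
    then show "Matrix.mat (n + 2) (n + 2) (\<lambda>(i, l). ?b i l) $$ (i, l)
        = four_block_mat ?N (0\<^sub>m n 2) ?A ?B $$ (i, l)"
      if "i < dim_row (four_block_mat ?N (0\<^sub>m n 2) ?A ?B)"
         "l < dim_col (four_block_mat ?N (0\<^sub>m n 2) ?A ?B)" for i l
      using that by (auto simp: not_less)
  qed auto
  finally show ?thesis
    by (simp add: det_four_block_mat_upper_right_zero[of _ n _ 2])
qed

text \<open>Finding the lower coefficients of \<open>p\<close> is a linear system whose matrix is the transpose of the
  given one, with minus the row of index \<open>k\<close> as right-hand side.\<close>

lemma ex1_monic_row_relation: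
  fixes m :: "nat \<Rightarrow> nat \<Rightarrow> 'a :: field"
  assumes "Determinant.det (Matrix.mat k k (\<lambda>(i, l). m i l)) \<noteq> 0"
  shows "\<exists>!p. degree p = k \<and> lead_coeff p = 1 \<and> (\<forall>l<k. (\<Sum>j\<le>degree p. coeff p j * m j l) = 0)"
proof -
  define M where "M = Matrix.mat k k (\<lambda>(l, i). m i l)"
  have M: "M \<in> carrier_mat k k" by (simp add: M_def)
  have "M = (Matrix.mat k k (\<lambda>(i, l). m i l))\<^sup>T"
    by (auto simp: M_def)
  then have "Determinant.det M \<noteq> 0" using assms by (simp add: det_transpose[of _ k])
  from det_non_zero_imp_unit[OF M this, of "()"]
  obtain B where B: "B \<in> carrier_mat k k" "B * M = 1\<^sub>m k" "M * B = 1\<^sub>m k"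
    by (auto simp: Units_def ring_mat_def)
  have mult: "(M *\<^sub>v v) $ l = (\<Sum>j<k. v $ j * m j l)" if "v \<in> carrier_vec k" "l < k" for v l
    using that by (simp add: M_def scalar_prod_def atLeast0LessThan mult.commute)
  have split: "(\<Sum>j\<le>degree p. coeff p j * m j l) = (\<Sum>j<k. coeff p j * m j l) + m k l"
    if "degree p = k" "lead_coeff p = 1" for p l
    using that by (simp flip: lessThan_Suc_atMost)
  define q where "q = B *\<^sub>v vec k (\<lambda>l. - m k l)"
  have q: "q \<in> carrier_vec k" using B by (simp add: q_def)
  have "M *\<^sub>v q = vec k (\<lambda>l. - m k l)"
    unfolding q_def using M B by (simp add: assoc_mult_mat_vec[symmetric, of _ k k _ k])
  then have sol: "(\<Sum>j<k. q $ j * m j l) = - m k l" if "l < k" for l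
    using mult[OF q that] that by simp
  define p where "p = monom 1 k + (\<Sum>j<k. monom (q $ j) j)"
  have coeff_p: "coeff p i = (if i < k then q $ i else if i = k then 1 else 0)" for i
    by (auto simp: p_def coeff_sum)
  have deg: "degree p = k"
    by (rule antisym) (auto intro: degree_le le_degree simp: coeff_p)
  show ?thesis
  proof (rule ex1I[of _ p], safe)
    show "degree p = k" "lead_coeff p = 1" using deg coeff_p by auto
    show "(\<Sum>j\<le>degree p. coeff p j * m j l) = 0" if "l < k" for l
      using split[of p l] sol[OF that] deg coeff_p by simp
    fix p'
    assume p': "k = degree p'" "lead_coeff p' = 1"
      "\<forall>l<degree p'. (\<Sum>j\<le>degree p'. coeff p' j * m j l) = 0"
    define v where "v = vec k (coeff p')"
    have "M *\<^sub>v v = vec k (\<lambda>l. - m k l)"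
    proof (rule eq_vecI)
      show "(M *\<^sub>v v) $ l = vec k (\<lambda>l. - m k l) $ l" if "l < dim_vec (vec k (\<lambda>l. - m k l))" for l
        using that p' split[of p' l] by (simp add: mult v_def eq_neg_iff_add_eq_0)
    qed (use M in auto)
    then have "(B * M) *\<^sub>v v = q"
      unfolding q_def using M B by (subst assoc_mult_mat_vec[of _ k k _ k]) (auto simp: v_def)
    then have "v = q" by (simp add: B v_def)
    then have "q $ i = coeff p' i" if "i < k" for i
      using that by (auto simp: v_def)
    then have "coeff p' i = coeff p i" for i
      using p' by (cases "i < k") (auto simp: coeff_p coeff_eq_0)
    then show "p' = p" by (intro poly_eqI)
  qed
qed

section \<open>The multiple integral as a determinant\<close>

lemma permutes_lessThan: "(p :: nat \<Rightarrow> nat) permutes {0..<n} \<Longrightarrow> j < n \<Longrightarrow> p j < n"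
  using permutes_in_image[of p "{0..<n}" j] by auto

text \<open>For each fixed \<open>q\<close>, the substitution of \<open>p \<circ> q\<close> for \<open>p\<close> turns the sum over \<open>p\<close> into the determinant.\<close>

lemma sum_sum_permutations_eq_fact_det:
  fixes A :: "nat \<Rightarrow> nat \<Rightarrow> 'a :: comm_ring_1"
  shows "(\<Sum>p | p permutes {0..<n}. \<Sum>q | q permutes {0..<n}.
            signof p * signof q * (\<Prod>j<n. A (q j) (p j)))
       = of_nat (fact n) * Determinant.det (Matrix.mat n n (\<lambda>(i, l). A i l))"
proof -
  let ?P = "{p. p permutes {0..<n}}"
  have "(\<Sum>p\<in>?P. signof p * signof q * (\<Prod>j<n. A (q j) (p j)))
      = Determinant.det (Matrix.mat n n (\<lambda>(i, l). A i l))" if q: "q permutes {0..<n}" for q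
  proof -
    have "(\<Sum>p\<in>?P. signof p * signof q * (\<Prod>j<n. A (q j) (p j)))
        = (\<Sum>p\<in>?P. signof (p \<circ> q) * signof q * (\<Prod>j<n. A (q j) ((p \<circ> q) j)))"
      by (rule sum_permutations_compose_right[OF q])
    also have "\<dots> = (\<Sum>p\<in>?P. signof p * (\<Prod>i = 0..<n. A i (p i)))"
    proof (intro sum.cong refl)
      fix p assume "p \<in> ?P"
      then have p: "p permutes {0..<n}" by simp
      have "sign (p \<circ> q) * sign q = sign p"
        using sign_compose[of p q] permutation_permutes p q
        by (metis finite_atLeastLessThan mult.assoc mult.right_neutral sign_idempotent)
      then have "signof (p \<circ> q) * signof q = (signof p :: 'a)"
        by (metis of_int_mult)
      moreover have "(\<Prod>j<n. A (q j) ((p \<circ> q) j)) = (\<Prod>i = 0..<n. A i (p i))"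
        using prod.permute[OF q, of "\<lambda>i. A i (p i)"] by (simp add: atLeast0LessThan comp_def)
      ultimately show "signof (p \<circ> q) * signof q * (\<Prod>j<n. A (q j) ((p \<circ> q) j))
          = signof p * (\<Prod>i = 0..<n. A i (p i))" by metis
    qed
    also have "\<dots> = Determinant.det (Matrix.mat n n (\<lambda>(i, l). A i l))"
      by (subst det_def'[of _ n]) (auto intro!: sum.cong prod.cong simp: permutes_lessThan)
    finally show ?thesis .
  qed
  then show ?thesis
    by (subst sum.swap) (simp add: card_permutations[of _ n])
qed

text \<open>Andreief's identity. Expanded over permutations \<open>p\<close> and \<open>q\<close>, the two determinants give products of
  functions of one variable, the \<open>j\<close>-th of which integrates to the entry in row \<open>q j\<close> and column \<open>p j\<close>.\<close>

lemma iterated_circle_integral_andreief: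
  fixes f :: "complex \<Rightarrow> complex" and \<phi> \<psi> :: "nat \<Rightarrow> complex \<Rightarrow> complex"
  assumes int: "\<And>i l. i < n \<Longrightarrow> l < n \<Longrightarrow> integrable_on_circle (\<lambda>x. f x * \<phi> l x * \<psi> i x)"
  shows "iterated_circle_integral n (\<lambda>\<zeta>. (\<Prod>j<n. f (\<zeta> (Suc j))) *
           (Determinant.det (Matrix.mat n n (\<lambda>(l, j). \<phi> l (\<zeta> (Suc j)))) *
            Determinant.det (Matrix.mat n n (\<lambda>(i, j). \<psi> i (\<zeta> (Suc j))))))
       = fact n * Determinant.det (Matrix.mat n n (\<lambda>(i, l). circle_integral (\<lambda>x. f x * \<phi> l x * \<psi> i x)))"
proof -
  let ?P = "{p. p permutes {0..<n}}"
  have det: "Determinant.det (Matrix.mat n n (\<lambda>(l, j). h l (\<zeta> (Suc j))))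
      = (\<Sum>p\<in>?P. signof p * (\<Prod>j<n. h (p j) (\<zeta> (Suc j))))"
    for h :: "nat \<Rightarrow> complex \<Rightarrow> complex" and \<zeta> :: "nat \<Rightarrow> complex"
    by (subst det_col[of _ n]) (auto intro!: sum.cong prod.cong simp: permutes_lessThan)
  let ?c = "\<lambda>(p, q). signof p * signof q :: complex"
  let ?g = "\<lambda>(p, q) j x. f x * \<phi> (p j) x * \<psi> (q j) x"
  have "(\<lambda>\<zeta>. (\<Prod>j<n. f (\<zeta> (Suc j))) *
           (Determinant.det (Matrix.mat n n (\<lambda>(l, j). \<phi> l (\<zeta> (Suc j)))) *
            Determinant.det (Matrix.mat n n (\<lambda>(i, j). \<psi> i (\<zeta> (Suc j))))))
      = (\<lambda>\<zeta>. \<Sum>s\<in>?P \<times> ?P. ?c s * (\<Prod>j<n. ?g s j (\<zeta> (Suc j))))"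
    unfolding det sum_product
    unfolding sum_distrib_left sum.cartesian_product
    by (auto simp: prod.distrib mult_ac intro!: ext sum.cong)
  moreover have "iterated_circle_integral n
        (\<lambda>\<zeta>. \<Sum>s\<in>?P \<times> ?P. ?c s * (\<Prod>j<n. ?g s j (\<zeta> (Suc j))))
      = (\<Sum>s\<in>?P \<times> ?P. ?c s * (\<Prod>j<n. circle_integral (?g s j)))"
    by (rule iterated_circle_integral_sum_prod)
      (auto intro!: int simp: permutes_lessThan finite_permutations)
  moreover have "\<dots> = (\<Sum>p\<in>?P. \<Sum>q\<in>?P. signof p * signof q *
        (\<Prod>j<n. circle_integral (\<lambda>x. f x * \<phi> (p j) x * \<psi> (q j) x)))"
    by (simp add: sum.cartesian_product case_prod_unfold)
  ultimately show ?thesis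
    using sum_sum_permutations_eq_fact_det[where n = n
        and A = "\<lambda>i l. circle_integral (\<lambda>x. f x * \<phi> l x * \<psi> i x)"] by simp
qed

lemma D_multi_eq_det:
  assumes "\<And>i l. i < n \<Longrightarrow> l < n \<Longrightarrow> integrable_on_circle (\<lambda>x. f x * x ^ l * (x powi (-2)) ^ i)"
  shows "D_multi n f =
    Determinant.det (Matrix.mat n n (\<lambda>(i, l). circle_integral (\<lambda>x. f x * x ^ l * (x powi (-2)) ^ i)))"
proof -
  have "(\<Prod>j = 1..n. f (\<zeta> j)) *
          (\<Prod>k = 1..n. \<Prod>j = 1..<k. (\<zeta> k - \<zeta> j) * (\<zeta> k powi (-2) - \<zeta> j powi (-2)))
      = (\<Prod>j<n. f (\<zeta> (Suc j))) *
          (Determinant.det (Matrix.mat n n (\<lambda>(l, j). \<zeta> (Suc j) ^ l)) *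
           Determinant.det (Matrix.mat n n (\<lambda>(i, j). (\<zeta> (Suc j) powi (-2)) ^ i)))" for \<zeta>
  proof -
    have shift: "(\<Prod>j = 1..m. h j) = (\<Prod>j<m. h (Suc j))" for m and h :: "nat \<Rightarrow> complex"
      by (simp add: prod.atLeast1_atMost_eq)
    have shift': "(\<Prod>j = 1..<Suc m. h j) = (\<Prod>j<m. h (Suc j))" for m and h :: "nat \<Rightarrow> complex"
      by (metis atLeastLessThanSuc_atLeastAtMost shift)
    show ?thesis
      unfolding shift shift' by (simp add: det_vandermonde prod.distrib)
  qed
  then show ?thesis
    unfolding D_multi_def using iterated_circle_integral_andreief[OF assms, of n] by simp
qed

section \<open>The bordered determinant\<close>

text \<open>Integrated term by term, the conditions in the definition of \<open>Q_poly\<close> are linear equations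
  for the coefficients; the matrix of the system is the transpose of that of \<open>D_det\<close>. The description therefore determines a unique
  polynomial as soon as this determinant is nonzero.\<close>

lemma Q_poly_monic_orthogonal:
  assumes w: "integrable_on_circle w" and "D_det w r k \<noteq> 0"
  shows degree_Q_poly: "degree (Q_poly w r k) = k"
    and lead_coeff_Q_poly: "lead_coeff (Q_poly w r k) = 1"
    and Q_poly_orthogonal:
      "l < k \<Longrightarrow> (\<Sum>j\<le>k. coeff (Q_poly w r k) j * moment w (r + 2 * int j - int l)) = 0"
proof -
  let ?m = "\<lambda>j l. moment w (r + 2 * int j - int l)"
  let ?R = "\<lambda>p. degree p = k \<and> lead_coeff p = 1 \<and> (\<forall>l<k. (\<Sum>j\<le>degree p. coeff p j * ?m j l) = 0)"
  have ex: "\<exists>!p. ?R p"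
    by (rule ex1_monic_row_relation) (use assms(2) in \<open>simp add: D_det_def algebra_simps\<close>)
  have "Q_poly w r k = (THE p. ?R p)"
    unfolding Q_poly_def circle_integral_poly_moments(2)[OF w] by (simp add: algebra_simps)
  moreover obtain q where q: "?R q" using ex by blast
  ultimately have Q: "Q_poly w r k = q"
    using the1_equality[OF ex q] by (simp only:)
  have R: "?R (Q_poly w r k)"
    unfolding Q by (rule q)
  show "degree (Q_poly w r k) = k" "lead_coeff (Q_poly w r k) = 1" using R by auto
  show "l < k \<Longrightarrow> (\<Sum>j\<le>k. coeff (Q_poly w r k) j * ?m j l) = 0" using R by auto
qed

text \<open>The columns of the matrix in \<open>F2\<close>, extended linearly from the monomials to all polynomials.\<close>

definition bordered_entry ::
    "(complex \<Rightarrow> complex) \<Rightarrow> int \<Rightarrow> nat \<Rightarrow> complex \<Rightarrow> complex \<Rightarrow> complex poly \<Rightarrow> nat \<Rightarrow> complex" where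
  "bordered_entry w r n z1 z2 p l =
     (if l < n then \<Sum>j\<le>degree p. coeff p j * moment w (r + 2 * int j - int l)
      else if l = n then poly p z2 else poly p z1)"

lemma F2_monic_basis:
  assumes "\<And>i. i < n + 2 \<Longrightarrow> degree (p i) = i" "\<And>i. i < n + 2 \<Longrightarrow> lead_coeff (p i) = 1"
  shows "F2 w r n z1 z2 = 1 / (z1 - z2) *
    Determinant.det (Matrix.mat (n + 2) (n + 2) (\<lambda>(i, l). bordered_entry w r n z1 z2 (p i) l))"
proof -
  let ?a = "\<lambda>j l. if l < n then moment w (r + 2 * int j - int l) else if l = n then z2 ^ j else z1 ^ j"
  have "(\<Sum>j\<le>i. coeff (p i) j * ?a j l) = bordered_entry w r n z1 z2 (p i) l" if "i < n + 2" for i l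
    using assms(1)[OF that] by (simp add: bordered_entry_def poly_altdef)
  then have "Matrix.mat (n + 2) (n + 2) (\<lambda>(i, l). \<Sum>j\<le>i. coeff (p i) j * ?a j l)
      = Matrix.mat (n + 2) (n + 2) (\<lambda>(i, l). bordered_entry w r n z1 z2 (p i) l)"
    by (intro eq_matI) auto
  then show ?thesis
    using det_monic_rows[of "n + 2" p ?a] assms by (simp add: F2_def)
qed

text \<open>The factor \<open>(z1 - u) (z2 - u)\<close> of the integrand kills the border columns when it is moved into
  the row polynomials.\<close>

lemma F2_eq_D_multi:
  assumes w: "integrable_on_circle w" and "z1 \<noteq> z2"
  shows "F2 w r n z1 z2 =
    D_multi n (\<lambda>\<zeta>. w \<zeta> * \<zeta> powi (- r) * (z1 - \<zeta> powi (-2)) * (z2 - \<zeta> powi (-2)))"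
proof -
  define f where "f \<zeta> = w \<zeta> * \<zeta> powi (- r) * (z1 - \<zeta> powi (-2)) * (z2 - \<zeta> powi (-2))" for \<zeta>
  define s where "s i = [:- z1, 1:] * [:- z2, 1:] * monom 1 i" for i
  define p where "p i = (if i = 0 then 1 else if i = 1 then [:- z2, 1:] else s (i - 2))" for i
  let ?b = "\<lambda>i. bordered_entry w r n z1 z2 (p i)"
  have "degree (s i) = i + 2" for i
    unfolding s_def by (simp add: degree_mult_eq degree_monom_eq monom_eq_0_iff del: mult_pCons_left)
  then have deg: "degree (p i) = i" for i
    by (auto simp: p_def)
  have lead: "lead_coeff (p i) = 1" for i
    unfolding p_def s_def by (simp add: lead_coeff_mult degree_monom_eq del: mult_pCons_left)
  have poly_s: "poly (s i) x = (z1 - x) * (z2 - x) * x ^ i" for i x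
    by (simp add: s_def poly_monom algebra_simps)
  have f_eq: "f \<zeta> * \<zeta> ^ l * (\<zeta> powi (-2)) ^ i = poly (s i) (\<zeta> powi (-2)) * \<zeta> powi (int l - r) * w \<zeta>"
    if "norm \<zeta> = 1" for i l \<zeta>
  proof -
    have "\<zeta> \<noteq> 0" using that by auto
    then have "\<zeta> powi (int l - r) = \<zeta> ^ l * \<zeta> powi (- r)"
      by (simp add: power_int_add[symmetric] flip: power_int_of_nat)
    then show ?thesis by (simp add: f_def poly_s)
  qed
  have "Determinant.det (Matrix.mat (n + 2) (n + 2) (\<lambda>(i, l). ?b i l))
      = Determinant.det (Matrix.mat n n (\<lambda>(i, l). ?b (i + 2) l)) *
        Determinant.det (Matrix.mat 2 2 (\<lambda>(i, l). ?b i (n + l)))"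
    by (rule det_block_lower_right_zero) (auto simp: bordered_entry_def p_def poly_s)
  also have "Determinant.det (Matrix.mat 2 2 (\<lambda>(i, l). ?b i (n + l))) = z1 - z2"
    by (subst det_two_by_two) (simp add: bordered_entry_def p_def)
  also have "Determinant.det (Matrix.mat n n (\<lambda>(i, l). ?b (i + 2) l)) = D_multi n f"
  proof -
    have "circle_integral (\<lambda>x. f x * x ^ l * (x powi (-2)) ^ i) = ?b (i + 2) l" if "l < n" for i l
    proof -
      have "circle_integral (\<lambda>x. f x * x ^ l * (x powi (-2)) ^ i)
          = circle_integral (\<lambda>\<zeta>. poly (s i) (\<zeta> powi (-2)) * \<zeta> powi (int l - r) * w \<zeta>)"
        by (rule circle_integral_cong[OF f_eq])
      also have "\<dots> = (\<Sum>j\<le>degree (s i). coeff (s i) j * moment w (2 * int j - (int l - r)))"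
        by (rule circle_integral_poly_moments(2)[OF w])
      finally show ?thesis using that by (simp add: bordered_entry_def p_def algebra_simps)
    qed
    moreover have "integrable_on_circle (\<lambda>x. f x * x ^ l * (x powi (-2)) ^ i)" for i l
      by (subst integrable_on_circle_cong[OF f_eq]) (auto intro: circle_integral_poly_moments(1)[OF w])
    ultimately show ?thesis
      by (subst D_multi_eq_det) (auto intro!: arg_cong[where f = Determinant.det] eq_matI)
  qed
  finally show ?thesis
    using F2_monic_basis[of n p w r z1 z2] deg lead assms(2) by (simp add: f_def[abs_def])
qed

text \<open>Orthogonality says that the \<open>n\<close> moment columns annihilate \<open>Q_n\<close>. They annihilate \<open>Q_(n+1)\<close>
  too, which satisfies the analogous conditions for one further index \<open>l\<close>.\<close>

lemma F2_eq_Q_poly: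
  assumes w: "integrable_on_circle w" and "D_det w r n \<noteq> 0" "D_det w r (n + 1) \<noteq> 0"
  shows "F2 w r n z1 z2 = D_det w r n *
           (poly (Q_poly w r n) z1 * poly (Q_poly w r (n + 1)) z2
            - poly (Q_poly w r n) z2 * poly (Q_poly w r (n + 1)) z1) / (z2 - z1)"
proof -
  define p where "p i = (if i < n then monom 1 i else Q_poly w r i)" for i
  let ?b = "\<lambda>i. bordered_entry w r n z1 z2 (p i)"
  have D: "D_det w r i \<noteq> 0" if "n \<le> i" "i < n + 2" for i
    using assms that by (cases "i = n") (auto simp: le_less_Suc_eq less_Suc_eq)
  have deg: "degree (p i) = i" and lead: "lead_coeff (p i) = 1" if "i < n + 2" for i
    using D[of i] that degree_Q_poly[OF w, of r i] lead_coeff_Q_poly[OF w, of r i]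
    by (auto simp: p_def degree_monom_eq)
  have "Determinant.det (Matrix.mat (n + 2) (n + 2) (\<lambda>(i, l). ?b i l))
      = Determinant.det (Matrix.mat n n (\<lambda>(i, l). ?b i l)) *
        Determinant.det (Matrix.mat 2 2 (\<lambda>(i, l). ?b (n + i) (n + l)))"
  proof (rule det_block_lower_left_zero)
    fix i l assume "n \<le> i" "i < n + 2" "l < n"
    then show "?b i l = 0"
      using D[of i] w by (simp add: p_def bordered_entry_def degree_Q_poly Q_poly_orthogonal)
  qed
  also have "Determinant.det (Matrix.mat 2 2 (\<lambda>(i, l). ?b (n + i) (n + l)))
      = poly (Q_poly w r n) z2 * poly (Q_poly w r (n + 1)) z1
        - poly (Q_poly w r n) z1 * poly (Q_poly w r (n + 1)) z2"
    by (subst det_two_by_two) (simp add: bordered_entry_def p_def)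
  also have "Determinant.det (Matrix.mat n n (\<lambda>(i, l). ?b i l)) = D_det w r n"
  proof -
    have "?b i l = moment w (2 * int i - int l + r)" if "i < n" "l < n" for i l
    proof -
      have "(\<Sum>j\<le>i. coeff (monom 1 i) j * moment w (r + 2 * int j - int l))
          = (\<Sum>j\<le>i. if j = i then moment w (r + 2 * int j - int l) else 0)"
        by (intro sum.cong) auto
      then show ?thesis
        using that by (simp add: bordered_entry_def p_def degree_monom_eq algebra_simps)
    qed
    then show ?thesis
      unfolding D_det_def by (auto intro!: arg_cong[where f = Determinant.det] eq_matI)
  qed
  finally have "F2 w r n z1 z2 = 1 / (z1 - z2) * (D_det w r n *
      (poly (Q_poly w r n) z2 * poly (Q_poly w r (n + 1)) z1
        - poly (Q_poly w r n) z1 * poly (Q_poly w r (n + 1)) z2))"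
    using F2_monic_basis[of n p w r z1 z2] deg lead by simp
  moreover have "1 / (z1 - z2) * (d * (b - a)) = d * (a - b) / (z2 - z1)" for a b d
  proof -
    have "z1 - z2 = - (z2 - z1)" "d * (b - a) = - (d * (a - b))"
      by (simp_all add: algebra_simps)
    then show ?thesis
      by (simp only: minus_divide_divide times_divide_eq_left mult_1_left)
  qed
  ultimately show ?thesis by simp
qed

theorem lemma9:
  fixes w :: "complex \<Rightarrow> complex" and r :: int and n :: nat and z1 z2 :: complex
  assumes "integrable_on_circle w"
    and "n \<ge> 1"
    and "z1 \<noteq> z2"
    and "\<And>k. k \<le> n + 1 \<Longrightarrow> D_det w r k \<noteq> 0"
  shows "F2 w r n z1 z2 =
           D_multi n (\<lambda>\<zeta>. w \<zeta> * \<zeta> powi (- r) * (z1 - \<zeta> powi (-2)) * (z2 - \<zeta> powi (-2)))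
       \<and> D_multi n (\<lambda>\<zeta>. w \<zeta> * \<zeta> powi (- r) * (z1 - \<zeta> powi (-2)) * (z2 - \<zeta> powi (-2))) =
           D_det w r n *
           (poly (Q_poly w r n) z1 * poly (Q_poly w r (n + 1)) z2
            - poly (Q_poly w r n) z2 * poly (Q_poly w r (n + 1)) z1) / (z2 - z1)"
  using F2_eq_D_multi[OF assms(1,3), of r n] F2_eq_Q_poly[OF assms(1), of r n z1 z2] assms(4) by simp

end
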